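(* Let $G$ be a group and let $R$ be a $G$-graded ring such that every proper graded ideal of $R$ is a graded weakly prime ideal of $R$. If $R$ has two distinct graded maximal ideals $X_1$ and $X_2$, then their product is zero, i.e. $X_1X_2=0$ and $X_2X_1=0$. Moreover, if in addition $R$ has a unity, then $R$ is (isomorphic to) a direct sum of two graded simple rings.
   Context: Rings are associative, not necessarily commutative and not necessarily with unity; ideals are two-sided. A ring $R$ is $G$-graded if $R=\bigoplus_{g\in G}R_g$ with additive subgroups $R_g$ satisfying $R_gR_h\subseteq R_{gh}$ for all $g,h\in G$. An ideal $I$ of $R$ is graded if $I=\bigoplus_{g\in G}(I\cap R_g)$. The product $IJ$ of ideals is the additive subgroup of all finite sums of products $xy$ with $x\in I$, $y\in J$. A proper graded ideal $P$ of $R$ is a graded weakly prime ideal of $R$ if whenever $I,J$ are graded ideals of $R$ with $0\neq IJ\subseteq P$, then $I\subseteq P$ or $J\subseteq P$. A graded maximal ideal is a proper graded ideal that is maximal among proper graded ideals of $R$. A nonzero graded ring with unity is graded simple if its only graded ideals are $0$ and the whole ring. *)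

theory Defs
  imports "HOL-Algebra.Ideal_Product" "HOL-Algebra.Chinese_Remainder"
begin

(* The library locale ring requires a unity. Here the "one" field of the record is left
   unconstrained; "R has a unity" is then the library's "ring R", with the "one" field of R
   as the unity. *)
locale nonunital_ring = abelian_group R for R (structure) +
  assumes m_closed: "\<lbrakk>x \<in> carrier R; y \<in> carrier R\<rbrakk> \<Longrightarrow> x \<otimes> y \<in> carrier R"
    and m_assoc: "\<lbrakk>x \<in> carrier R; y \<in> carrier R; z \<in> carrier R\<rbrakk>
                    \<Longrightarrow> (x \<otimes> y) \<otimes> z = x \<otimes> (y \<otimes> z)"
    and l_distr: "\<lbrakk>x \<in> carrier R; y \<in> carrier R; z \<in> carrier R\<rbrakk>
                    \<Longrightarrow> (x \<oplus> y) \<otimes> z = x \<otimes> z \<oplus> y \<otimes> z"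
    and r_distr: "\<lbrakk>x \<in> carrier R; y \<in> carrier R; z \<in> carrier R\<rbrakk>
                    \<Longrightarrow> z \<otimes> (x \<oplus> y) = z \<otimes> x \<oplus> z \<otimes> y"

(* The library locale ideal with nonunital_ring in place of ring. *)
locale nonunital_ideal = additive_subgroup I R + nonunital_ring R for I and R (structure) +
  assumes I_l_closed: "\<lbrakk>a \<in> I; x \<in> carrier R\<rbrakk> \<Longrightarrow> x \<otimes> a \<in> I"
    and I_r_closed: "\<lbrakk>a \<in> I; x \<in> carrier R\<rbrakk> \<Longrightarrow> a \<otimes> x \<in> I"

lemma (in ring) nonunital_ring: "nonunital_ring R"
  by unfold_locales (auto simp: m_assoc l_distr r_distr)

lemma (in ring) nonunital_ideal_iff_ideal: "nonunital_ideal I R \<longleftrightarrow> ideal I R"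
  by (simp add: nonunital_ideal_def ideal_def nonunital_ideal_axioms_def ideal_axioms_def
      nonunital_ring ring_axioms)

(* B is the internal direct sum of the additive subgroups A k, k in K: every element of B is
   a sum of a unique finitely supported family of components. The family is a function
   undefined outside K, which makes uniqueness of the function the right notion. *)
definition internal_direct_sum ::
  "('a, 'm) ring_scheme \<Rightarrow> 'a set \<Rightarrow> 'k set \<Rightarrow> ('k \<Rightarrow> 'a set) \<Rightarrow> bool" where
  "internal_direct_sum R B K A \<longleftrightarrow>
     additive_subgroup B R \<and>
     (\<forall>k\<in>K. additive_subgroup (A k) R \<and> A k \<subseteq> B) \<and>
     (\<forall>x\<in>B. \<exists>!f. f \<in> (\<Pi>\<^sub>E k\<in>K. A k) \<and> finite {k\<in>K. f k \<noteq> \<zero>\<^bsub>R\<^esub>} \<and>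
               x = (\<Oplus>\<^bsub>R\<^esub>k\<in>{k\<in>K. f k \<noteq> \<zero>\<^bsub>R\<^esub>}. f k))"

(* A g is the homogeneous component of degree g. *)
locale graded_ring = G?: group G + R?: nonunital_ring R
  for G (structure) and R (structure) +
  fixes A
  assumes direct_sum: "internal_direct_sum R (carrier R) (carrier G) A"
    and graded_mult: "\<lbrakk>g \<in> carrier G; h \<in> carrier G; x \<in> A g; y \<in> A h\<rbrakk>
                        \<Longrightarrow> x \<otimes>\<^bsub>R\<^esub> y \<in> A (g \<otimes>\<^bsub>G\<^esub> h)"

definition graded_ideal ::
  "('g, 'n) monoid_scheme \<Rightarrow> ('a, 'm) ring_scheme \<Rightarrow> ('g \<Rightarrow> 'a set) \<Rightarrow> 'a set \<Rightarrow> bool" where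
  "graded_ideal G R A I \<longleftrightarrow>
     nonunital_ideal I R \<and> internal_direct_sum R I (carrier G) (\<lambda>g. I \<inter> A g)"

definition proper_graded_ideal ::
  "('g, 'n) monoid_scheme \<Rightarrow> ('a, 'm) ring_scheme \<Rightarrow> ('g \<Rightarrow> 'a set) \<Rightarrow> 'a set \<Rightarrow> bool" where
  "proper_graded_ideal G R A I \<longleftrightarrow> graded_ideal G R A I \<and> I \<noteq> carrier R"

definition graded_weakly_prime_ideal ::
  "('g, 'n) monoid_scheme \<Rightarrow> ('a, 'm) ring_scheme \<Rightarrow> ('g \<Rightarrow> 'a set) \<Rightarrow> 'a set \<Rightarrow> bool" where
  "graded_weakly_prime_ideal G R A P \<longleftrightarrow>
     proper_graded_ideal G R A P \<and>
     (\<forall>I J. graded_ideal G R A I \<longrightarrow> graded_ideal G R A J \<longrightarrow>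
            ideal_prod R I J \<noteq> {\<zero>\<^bsub>R\<^esub>} \<longrightarrow> ideal_prod R I J \<subseteq> P \<longrightarrow> I \<subseteq> P \<or> J \<subseteq> P)"

definition graded_maximal_ideal ::
  "('g, 'n) monoid_scheme \<Rightarrow> ('a, 'm) ring_scheme \<Rightarrow> ('g \<Rightarrow> 'a set) \<Rightarrow> 'a set \<Rightarrow> bool" where
  "graded_maximal_ideal G R A X \<longleftrightarrow>
     proper_graded_ideal G R A X \<and>
     (\<forall>I. proper_graded_ideal G R A I \<longrightarrow> X \<subseteq> I \<longrightarrow> I = X)"

definition graded_simple_ring ::
  "('g, 'n) monoid_scheme \<Rightarrow> ('a, 'm) ring_scheme \<Rightarrow> ('g \<Rightarrow> 'a set) \<Rightarrow> bool" where
  "graded_simple_ring G R A \<longleftrightarrow>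
     graded_ring G R A \<and> ring R \<and> carrier R \<noteq> {\<zero>\<^bsub>R\<^esub>} \<and>
     (\<forall>I. graded_ideal G R A I \<longrightarrow> I = {\<zero>\<^bsub>R\<^esub>} \<or> I = carrier R)"

(* Degree-preserving isomorphisms of unital graded rings. *)
definition graded_ring_iso ::
  "('g, 'n) monoid_scheme \<Rightarrow> ('a, 'm) ring_scheme \<Rightarrow> ('g \<Rightarrow> 'a set) \<Rightarrow>
   ('b, 'l) ring_scheme \<Rightarrow> ('g \<Rightarrow> 'b set) \<Rightarrow> ('a \<Rightarrow> 'b) set" where
  "graded_ring_iso G R A S B = {h \<in> ring_iso R S. \<forall>g\<in>carrier G. h ` A g = B g}"

end

theory Submission
  imports Defs
begin

text \<open>The intersection of distinct graded maximal ideals \<open>X1\<close>, \<open>X2\<close> contains neither of them, so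
weak primeness of \<open>X1 \<inter> X2\<close> forces \<open>X1 X2 = X2 X1 = 0\<close>. With a unity, maximality gives
\<open>1 = e + f\<close> with \<open>e \<in> X1\<close>, \<open>f \<in> X2\<close>, and \<open>y = y e + y f \<in> X2 X1 + X1 X2 = 0\<close> for
\<open>y \<in> X1 \<inter> X2\<close>. Hence \<open>R = X1 \<oplus> X2\<close>, and a graded ideal \<open>I\<close> of the ring \<open>X1\<close> is a graded ideal of
\<open>R\<close>, which is \<open>0\<close> or \<open>X1\<close> because \<open>I + X2\<close> is \<open>X2\<close> or \<open>R\<close>.\<close>

text \<open>The predicate repeats the one under the unique existence in
  \<open>internal_direct_sum\<close>, so that clause determines the value.
  \<open>component R K A x\<close> is the whole family of components of \<open>x\<close>; a further
  argument \<open>k\<close> picks one of them.\<close>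

definition component ::
  "('a, 'm) ring_scheme \<Rightarrow> 'k set \<Rightarrow> ('k \<Rightarrow> 'a set) \<Rightarrow> 'a \<Rightarrow> 'k \<Rightarrow> 'a" where
  "component R K A x = (THE f. f \<in> (\<Pi>\<^sub>E k\<in>K. A k) \<and> finite {k\<in>K. f k \<noteq> \<zero>\<^bsub>R\<^esub>} \<and>
               x = (\<Oplus>\<^bsub>R\<^esub>k\<in>{k\<in>K. f k \<noteq> \<zero>\<^bsub>R\<^esub>}. f k))"

section \<open>Products, intersections and sums of ideals and additive subgroups\<close>

lemma (in nonunital_ring) ideal_prod_subset_Int:
  assumes "nonunital_ideal I R" "nonunital_ideal J R"
  shows "ideal_prod R I J \<subseteq> I \<inter> J"
proof -
  interpret I: nonunital_ideal I R by fact
  interpret J: nonunital_ideal J R by fact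
  have "s \<in> I \<inter> J" if "s \<in> ideal_prod R I J" for s
    using that
    by (induct s rule: ideal_prod.induct) (auto intro: I.I_r_closed J.I_l_closed)
  then show ?thesis by blast
qed

lemma (in abelian_group) additive_subgroup_closedI:
  assumes "H \<subseteq> carrier G" "\<zero> \<in> H" "\<And>x y. x \<in> H \<Longrightarrow> y \<in> H \<Longrightarrow> x \<oplus> y \<in> H"
    "\<And>x. x \<in> H \<Longrightarrow> \<ominus> x \<in> H"
  shows "additive_subgroup H G"
  using assms
  by (intro additive_subgroupI add.subgroupI) (auto simp: a_inv_def)

lemma (in abelian_group) additive_subgroup_Int:
  assumes "additive_subgroup H G" "additive_subgroup K G"
  shows "additive_subgroup (H \<inter> K) G"
  using assms add.subgroups_Inter_pair by (simp add: additive_subgroup_def)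

lemma (in nonunital_ring) nonunital_ideal_Int:
  assumes "nonunital_ideal I R" "nonunital_ideal J R"
  shows "nonunital_ideal (I \<inter> J) R"
proof -
  interpret I: nonunital_ideal I R by fact
  interpret J: nonunital_ideal J R by fact
  show ?thesis
    by (intro nonunital_ideal.intro nonunital_ring_axioms additive_subgroup_Int
        I.is_additive_subgroup J.is_additive_subgroup nonunital_ideal_axioms.intro)
      (auto intro: I.I_l_closed I.I_r_closed J.I_l_closed J.I_r_closed)
qed

lemma (in nonunital_ring) nonunital_ideal_add:
  assumes "nonunital_ideal I R" "nonunital_ideal J R"
  shows "nonunital_ideal (I <+>\<^bsub>R\<^esub> J) R"
proof -
  interpret I: nonunital_ideal I R by fact
  interpret J: nonunital_ideal J R by fact
  show ?thesis
  proof (intro nonunital_ideal.intro nonunital_ring_axioms add_additive_subgroups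
        I.is_additive_subgroup J.is_additive_subgroup nonunital_ideal_axioms.intro)
    fix a x assume "a \<in> I <+>\<^bsub>R\<^esub> J" and x: "x \<in> carrier R"
    then obtain i j where "i \<in> I" "j \<in> J" "a = i \<oplus> j"
      by (auto simp: set_add_def')
    then show "x \<otimes> a \<in> I <+>\<^bsub>R\<^esub> J" "a \<otimes> x \<in> I <+>\<^bsub>R\<^esub> J"
      using x by (auto simp: set_add_def' l_distr r_distr
          intro: I.I_l_closed I.I_r_closed J.I_l_closed J.I_r_closed intro!: bexI)
  qed
qed

lemma (in abelian_group) subset_set_add:
  assumes "additive_subgroup I G" "additive_subgroup J G"
  shows "I \<subseteq> I <+>\<^bsub>G\<^esub> J" "J \<subseteq> I <+>\<^bsub>G\<^esub> J"
proof -
  interpret I: additive_subgroup I G by fact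
  interpret J: additive_subgroup J G by fact
  have "i \<oplus> \<zero> \<in> I <+>\<^bsub>G\<^esub> J" if "i \<in> I" for i
    using that J.zero_closed unfolding set_add_def' by blast
  then show "I \<subseteq> I <+>\<^bsub>G\<^esub> J" by (auto simp: I.a_Hcarr)
  have "\<zero> \<oplus> j \<in> I <+>\<^bsub>G\<^esub> J" if "j \<in> J" for j
    using that I.zero_closed unfolding set_add_def' by blast
  then show "J \<subseteq> I <+>\<^bsub>G\<^esub> J" by (auto simp: J.a_Hcarr)
qed

section \<open>Additive subgroups and direct sums under a change of carrier\<close>

lemma (in abelian_group) finsum_restrict_carrier:
  assumes S: "abelian_group S" "add S = add G" "zero S = zero G" "carrier S \<subseteq> carrier G"
    and f: "f \<in> F \<rightarrow> carrier S"
  shows "finsum S f F = finsum G f F"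
proof (cases "finite F")
  case True
  interpret S: abelian_group S by fact
  from True f show ?thesis
  proof (induction F)
    case (insert k F)
    then have "f \<in> F \<rightarrow> carrier S" "f k \<in> carrier S" by auto
    moreover from this have "f \<in> F \<rightarrow> carrier G" "f k \<in> carrier G" using S by auto
    ultimately show ?case using insert S by simp
  qed (simp add: S)
next
  \<comment> \<open>Sums over infinite sets are \<open>zero\<close> by definition, and the zeros
    agree.\<close>
  case False
  then show ?thesis
    by (simp add: S finsum_def finprod_def)
qed

lemma (in abelian_group) additive_subgroup_restrict_carrier:
  assumes S: "abelian_group S" "add S = add G" "zero S = zero G" "additive_subgroup (carrier S) G"
    and "B \<subseteq> carrier S"
  shows "additive_subgroup B S \<longleftrightarrow> additive_subgroup B G"
proof -
  interpret S: abelian_group S by fact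
  interpret C: additive_subgroup "carrier S" G by fact
  \<comment> \<open>The negative depends on the carrier, so agreement needs an argument: the
    negative in \<open>S\<close> is a left inverse in \<open>G\<close>, and such an inverse is
    unique.\<close>
  have inv: "\<ominus>\<^bsub>S\<^esub> x = \<ominus> x" if "x \<in> carrier S" for x
    using that S by (metis C.a_Hcarr S.add.inv_closed S.l_neg minus_equality)
  show ?thesis
  proof
    assume "additive_subgroup B S"
    then interpret B: additive_subgroup B S .
    show "additive_subgroup B G"
    proof (rule additive_subgroup_closedI)
      show "B \<subseteq> carrier G" using \<open>B \<subseteq> carrier S\<close> C.a_subset by (rule subset_trans)
      show "\<zero> \<in> B" using B.zero_closed S(3) by metis
      show "x \<oplus> y \<in> B" if "x \<in> B" "y \<in> B" for x y using B.a_closed[OF that] S(2) by metis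
      show "\<ominus> x \<in> B" if "x \<in> B" for x using B.a_inv_closed[OF that] inv that \<open>B \<subseteq> carrier S\<close> by (metis subsetD)
    qed
  next
    assume "additive_subgroup B G"
    then interpret B: additive_subgroup B G .
    show "additive_subgroup B S"
    proof (rule S.additive_subgroup_closedI)
      show "B \<subseteq> carrier S" by fact
      show "\<zero>\<^bsub>S\<^esub> \<in> B" using B.zero_closed S(3) by metis
      show "x \<oplus>\<^bsub>S\<^esub> y \<in> B" if "x \<in> B" "y \<in> B" for x y using B.a_closed[OF that] S(2) by metis
      show "\<ominus>\<^bsub>S\<^esub> x \<in> B" if "x \<in> B" for x using B.a_inv_closed[OF that] inv that \<open>B \<subseteq> carrier S\<close> by (metis subsetD)
    qed
  qed
qed

text \<open>The definition sees the ambient group only through sums, zero and the subgroup property,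
  and on \<open>carrier S\<close> these agree. This moves gradings between a ring and an ideal
  viewed as a ring of its own.\<close>

lemma (in abelian_group) internal_direct_sum_restrict_carrier:
  assumes S: "abelian_group S" "add S = add G" "zero S = zero G" "additive_subgroup (carrier S) G"
    and B: "B \<subseteq> carrier S" "\<And>k. k \<in> K \<Longrightarrow> C k \<subseteq> carrier S"
  shows "internal_direct_sum S B K C \<longleftrightarrow> internal_direct_sum G B K C"
proof -
  have "finsum S f {k \<in> K. f k \<noteq> \<zero>} = finsum G f {k \<in> K. f k \<noteq> \<zero>}"
    if "f \<in> (\<Pi>\<^sub>E k\<in>K. C k)" for f
    using that B(2) additive_subgroup.a_subset[OF S(4)]
    by (intro finsum_restrict_carrier S) (fastforce simp: PiE_iff)+
  then have decomp: "(f \<in> (\<Pi>\<^sub>E k\<in>K. C k) \<and> finite {k\<in>K. f k \<noteq> \<zero>\<^bsub>S\<^esub>} \<and>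
               x = (\<Oplus>\<^bsub>S\<^esub>k\<in>{k\<in>K. f k \<noteq> \<zero>\<^bsub>S\<^esub>}. f k)) \<longleftrightarrow>
             (f \<in> (\<Pi>\<^sub>E k\<in>K. C k) \<and> finite {k\<in>K. f k \<noteq> \<zero>} \<and>
               x = (\<Oplus>k\<in>{k\<in>K. f k \<noteq> \<zero>}. f k))" for f x
    using S by auto
  have sub: "additive_subgroup (C k) S \<longleftrightarrow> additive_subgroup (C k) G" if "k \<in> K" for k
    using additive_subgroup_restrict_carrier[OF S B(2)[OF that]] .
  show ?thesis
    unfolding internal_direct_sum_def additive_subgroup_restrict_carrier[OF S B(1)]
    by (simp only: decomp sub cong: ball_cong)
qed

section \<open>Homogeneous components and graded ideals\<close>

context graded_ring
begin

abbreviation "is_decomp x f \<equiv> f \<in> (\<Pi>\<^sub>E g\<in>carrier G. A g) \<and>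
  finite {g\<in>carrier G. f g \<noteq> \<zero>\<^bsub>R\<^esub>} \<and> x = (\<Oplus>\<^bsub>R\<^esub>g\<in>{g\<in>carrier G. f g \<noteq> \<zero>\<^bsub>R\<^esub>}. f g)"

abbreviation "proj \<equiv> component R (carrier G) A"

lemma homogeneous_subgroup: "g \<in> carrier G \<Longrightarrow> additive_subgroup (A g) R"
  using direct_sum by (simp add: internal_direct_sum_def)

lemma ex1_decomp: "x \<in> carrier R \<Longrightarrow> \<exists>!f. is_decomp x f"
  using direct_sum by (simp add: internal_direct_sum_def)

lemma is_decomp_proj: "x \<in> carrier R \<Longrightarrow> is_decomp x (proj x)"
  using theI'[OF ex1_decomp] unfolding component_def .

lemma proj_eqI: "x \<in> carrier R \<Longrightarrow> is_decomp x f \<Longrightarrow> proj x = f"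
  unfolding component_def by (rule the1_equality[OF ex1_decomp])

lemma proj_mem: "x \<in> carrier R \<Longrightarrow> g \<in> carrier G \<Longrightarrow> proj x g \<in> A g"
  using is_decomp_proj by blast

lemma proj_closed: "x \<in> carrier R \<Longrightarrow> g \<in> carrier G \<Longrightarrow> proj x g \<in> carrier R"
  by (rule additive_subgroup.a_Hcarr[OF homogeneous_subgroup proj_mem])

text \<open>The support of a sum can be smaller than the union of the supports, so uniqueness is
  extended to sums over any finite set that contains the support; the extra summands vanish.\<close>

lemma proj_eqI_finite:
  assumes f: "f \<in> (\<Pi>\<^sub>E g\<in>carrier G. A g)" and F: "finite F" "F \<subseteq> carrier G"
    and 0: "\<And>g. g \<in> carrier G - F \<Longrightarrow> f g = \<zero>\<^bsub>R\<^esub>" and x: "x = (\<Oplus>\<^bsub>R\<^esub>g\<in>F. f g)"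
  shows "proj x = f"
proof -
  have fR: "f g \<in> carrier R" if "g \<in> carrier G" for g
    using additive_subgroup.a_Hcarr[OF homogeneous_subgroup[OF that] PiE_mem[OF f that]] .
  have sub: "{g\<in>carrier G. f g \<noteq> \<zero>\<^bsub>R\<^esub>} \<subseteq> F" using 0 by auto
  have "x = (\<Oplus>\<^bsub>R\<^esub>g\<in>{g\<in>carrier G. f g \<noteq> \<zero>\<^bsub>R\<^esub>}. f g)"
    unfolding x using F sub fR
    by (intro R.add.finprod_mono_neutral_cong_right) auto
  moreover have "x \<in> carrier R"
    unfolding x using fR F by (intro R.finsum_closed) auto
  ultimately show ?thesis
    using f finite_subset[OF sub F(1)] by (intro proj_eqI conjI)
qed

lemma proj_add:
  assumes x: "x \<in> carrier R" and y: "y \<in> carrier R" and g: "g \<in> carrier G"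
  shows "proj (x \<oplus>\<^bsub>R\<^esub> y) g = proj x g \<oplus>\<^bsub>R\<^esub> proj y g"
proof -
  let ?supp = "\<lambda>x. {g\<in>carrier G. proj x g \<noteq> \<zero>\<^bsub>R\<^esub>}"
  let ?F = "?supp x \<union> ?supp y"
  have fin: "finite ?F" using is_decomp_proj x y by auto
  \<comment> \<open>Both decompositions are written over the common finite set \<open>?F\<close> by
    adding zero summands.\<close>
  have *: "z = (\<Oplus>\<^bsub>R\<^esub>g\<in>?F. proj z g)" if "z \<in> carrier R" "?supp z \<subseteq> ?F" for z
  proof -
    have "z = (\<Oplus>\<^bsub>R\<^esub>g\<in>?supp z. proj z g)"
      using is_decomp_proj[OF that(1)] by blast
    also have "\<dots> = (\<Oplus>\<^bsub>R\<^esub>g\<in>?F. proj z g)"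
      using that fin proj_closed
      by (intro R.add.finprod_mono_neutral_cong_left) auto
    finally show ?thesis .
  qed
  have "x \<oplus>\<^bsub>R\<^esub> y = (\<Oplus>\<^bsub>R\<^esub>g\<in>?F. proj x g) \<oplus>\<^bsub>R\<^esub> (\<Oplus>\<^bsub>R\<^esub>g\<in>?F. proj y g)"
    by (intro arg_cong2[where f = "add R"] * x y) auto
  also have "\<dots> = (\<Oplus>\<^bsub>R\<^esub>g\<in>?F. proj x g \<oplus>\<^bsub>R\<^esub> proj y g)"
    using x y proj_closed by (intro R.finsum_addf[symmetric]) auto
  \<comment> \<open>Families must be undefined outside \<open>carrier G\<close>, hence the
    restricted function.\<close>
  also have "\<dots> = (\<Oplus>\<^bsub>R\<^esub>g\<in>?F. (\<lambda>g\<in>carrier G. proj x g \<oplus>\<^bsub>R\<^esub> proj y g) g)"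
    using x y proj_closed by (intro R.finsum_cong') auto
  finally have "proj (x \<oplus>\<^bsub>R\<^esub> y) = (\<lambda>g\<in>carrier G. proj x g \<oplus>\<^bsub>R\<^esub> proj y g)"
    using fin x y additive_subgroup.a_closed[OF homogeneous_subgroup proj_mem proj_mem]
    by (intro proj_eqI_finite[where F = ?F]) auto
  then show ?thesis using g by simp
qed

lemma proj_homogeneous:
  assumes g: "g \<in> carrier G" and x: "x \<in> A g"
  shows "proj x g = x"
proof -
  have xR: "x \<in> carrier R"
    using additive_subgroup.a_Hcarr[OF homogeneous_subgroup[OF g] x] .
  have "proj x = (\<lambda>h\<in>carrier G. if h = g then x else \<zero>\<^bsub>R\<^esub>)"
    using g x xR
    by (intro proj_eqI_finite[where F = "{g}"])
      (auto intro: additive_subgroup.zero_closed[OF homogeneous_subgroup])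
  then show ?thesis using g by simp
qed

text \<open>A decomposition of \<open>x\<close> inside \<open>B\<close> is also one inside
  \<open>R\<close>, so by uniqueness it is \<open>proj x\<close>; conversely, closure under
  \<open>proj\<close> makes \<open>proj x\<close> a decomposition inside \<open>B\<close>.
  Gradedness thus becomes a closure property.\<close>

lemma internal_direct_sum_Int_iff:
  "internal_direct_sum R B (carrier G) (\<lambda>g. B \<inter> A g) \<longleftrightarrow>
     additive_subgroup B R \<and> (\<forall>x\<in>B. \<forall>g\<in>carrier G. proj x g \<in> B)"
proof (intro iffI conjI ballI)
  assume "internal_direct_sum R B (carrier G) (\<lambda>g. B \<inter> A g)"
  then have sub: "additive_subgroup B R"
    and ex: "\<And>x. x \<in> B \<Longrightarrow> \<exists>f. f \<in> (\<Pi>\<^sub>E g\<in>carrier G. B \<inter> A g) \<and>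
        finite {g\<in>carrier G. f g \<noteq> \<zero>\<^bsub>R\<^esub>} \<and> x = (\<Oplus>\<^bsub>R\<^esub>g\<in>{g\<in>carrier G. f g \<noteq> \<zero>\<^bsub>R\<^esub>}. f g)"
    unfolding internal_direct_sum_def by blast+
  show "additive_subgroup B R" by fact
  fix x g assume x: "x \<in> B" and g: "g \<in> carrier G"
  obtain f where f: "f \<in> (\<Pi>\<^sub>E g\<in>carrier G. B \<inter> A g)"
      "finite {g\<in>carrier G. f g \<noteq> \<zero>\<^bsub>R\<^esub>}" "x = (\<Oplus>\<^bsub>R\<^esub>g\<in>{g\<in>carrier G. f g \<noteq> \<zero>\<^bsub>R\<^esub>}. f g)"
    using ex[OF x] by blast
  from f(1) have "f \<in> (\<Pi>\<^sub>E g\<in>carrier G. A g)" by (auto simp: PiE_iff)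
  then have "proj x = f"
    by (intro proj_eqI conjI f(2,3) additive_subgroup.a_Hcarr[OF sub x])
  then show "proj x g \<in> B" using f(1) g by auto
next
  assume "additive_subgroup B R \<and> (\<forall>x\<in>B. \<forall>g\<in>carrier G. proj x g \<in> B)"
  then have sub: "additive_subgroup B R" and cl: "\<And>x g. x \<in> B \<Longrightarrow> g \<in> carrier G \<Longrightarrow> proj x g \<in> B"
    by auto
  have "\<exists>!f. f \<in> (\<Pi>\<^sub>E g\<in>carrier G. B \<inter> A g) \<and> finite {g\<in>carrier G. f g \<noteq> \<zero>\<^bsub>R\<^esub>} \<and>
          x = (\<Oplus>\<^bsub>R\<^esub>g\<in>{g\<in>carrier G. f g \<noteq> \<zero>\<^bsub>R\<^esub>}. f g)" if x: "x \<in> B" for x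
  proof -
    have xR: "x \<in> carrier R" using additive_subgroup.a_Hcarr[OF sub x] .
    have "proj x \<in> (\<Pi>\<^sub>E g\<in>carrier G. B \<inter> A g)"
      using is_decomp_proj[OF xR] cl[OF x] by (auto simp: PiE_iff)
    moreover have "f = proj x" if "f \<in> (\<Pi>\<^sub>E g\<in>carrier G. B \<inter> A g)"
      "finite {g\<in>carrier G. f g \<noteq> \<zero>\<^bsub>R\<^esub>}"
      "x = (\<Oplus>\<^bsub>R\<^esub>g\<in>{g\<in>carrier G. f g \<noteq> \<zero>\<^bsub>R\<^esub>}. f g)" for f
    proof -
      have "f \<in> (\<Pi>\<^sub>E g\<in>carrier G. A g)" using that(1) by (auto simp: PiE_iff)
      then show ?thesis by (intro proj_eqI[OF xR, symmetric] conjI that(2,3))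
    qed
    moreover note is_decomp_proj[OF xR]
    ultimately show ?thesis by (intro ex1I[of _ "proj x"] conjI) (elim conjE, assumption | simp)+
  qed
  then show "internal_direct_sum R B (carrier G) (\<lambda>g. B \<inter> A g)"
    unfolding internal_direct_sum_def
    using sub homogeneous_subgroup R.additive_subgroup_Int by auto
qed

lemma graded_ideal_iff:
  "graded_ideal G R A I \<longleftrightarrow>
     nonunital_ideal I R \<and> (\<forall>x\<in>I. \<forall>g\<in>carrier G. proj x g \<in> I)"
  unfolding graded_ideal_def internal_direct_sum_Int_iff
  using nonunital_ideal.axioms(1) by blast

lemma graded_ideal_Int:
  "graded_ideal G R A I \<Longrightarrow> graded_ideal G R A J \<Longrightarrow> graded_ideal G R A (I \<inter> J)"
  unfolding graded_ideal_iff using R.nonunital_ideal_Int by blast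

text \<open>By \<open>proj_add\<close>, a component of \<open>i + j\<close> is the sum of the
  components of \<open>i\<close> and \<open>j\<close>, which stay in \<open>I\<close> and
  \<open>J\<close>.\<close>

lemma graded_ideal_add:
  assumes "graded_ideal G R A I" "graded_ideal G R A J"
  shows "graded_ideal G R A (I <+>\<^bsub>R\<^esub> J)"
proof -
  have ids: "nonunital_ideal I R" "nonunital_ideal J R"
    using assms by (auto simp: graded_ideal_def)
  interpret I: nonunital_ideal I R by fact
  interpret J: nonunital_ideal J R by fact
  have "proj x g \<in> I <+>\<^bsub>R\<^esub> J" if "x \<in> I <+>\<^bsub>R\<^esub> J" "g \<in> carrier G" for x g
  proof -
    from that(1) obtain i j where ij: "i \<in> I" "j \<in> J" "x = i \<oplus>\<^bsub>R\<^esub> j"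
      by (auto simp: set_add_def')
    then have "proj x g = proj i g \<oplus>\<^bsub>R\<^esub> proj j g"
      using that(2) by (simp add: proj_add)
    moreover have "proj i g \<in> I" "proj j g \<in> J"
      using assms ij that(2) by (auto simp: graded_ideal_iff)
    ultimately show ?thesis by (auto simp: set_add_def')
  qed
  then show ?thesis
    using R.nonunital_ideal_add[OF ids] by (simp add: graded_ideal_iff)
qed

section \<open>Graded maximal ideals and their products\<close>

lemma graded_maximal_ideal_add:
  assumes X: "graded_maximal_ideal G R A X" and I: "graded_ideal G R A I" and "\<not> I \<subseteq> X"
  shows "I <+>\<^bsub>R\<^esub> X = carrier R"
proof (rule ccontr)
  assume "I <+>\<^bsub>R\<^esub> X \<noteq> carrier R"
  have gX: "graded_ideal G R A X"
    using X by (simp add: graded_maximal_ideal_def proper_graded_ideal_def)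
  then have "additive_subgroup I R" "additive_subgroup X R"
    using I by (auto simp: graded_ideal_def nonunital_ideal_def)
  then have sub: "I \<subseteq> I <+>\<^bsub>R\<^esub> X" "X \<subseteq> I <+>\<^bsub>R\<^esub> X"
    using R.subset_set_add by blast+
  \<comment> \<open>A proper graded ideal above \<open>X\<close> equals \<open>X\<close> by
    maximality, which would put \<open>I\<close> inside \<open>X\<close>.\<close>
  have "proper_graded_ideal G R A (I <+>\<^bsub>R\<^esub> X)"
    using \<open>I <+>\<^bsub>R\<^esub> X \<noteq> carrier R\<close> graded_ideal_add[OF I gX]
    by (simp add: proper_graded_ideal_def)
  then have "I <+>\<^bsub>R\<^esub> X = X"
    using X sub(2) unfolding graded_maximal_ideal_def by blast
  then show False using sub(1) assms(3) by simp
qed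

text \<open>If \<open>X\<close> lay in \<open>Y\<close>, then \<open>Y\<close>, being proper, would
  equal \<open>X\<close> by maximality of \<open>X\<close>.\<close>

lemma graded_maximal_ideals_not_subset:
  assumes "graded_maximal_ideal G R A X" "graded_maximal_ideal G R A Y" "X \<noteq> Y"
  shows "\<not> X \<subseteq> Y"
  using assms unfolding graded_maximal_ideal_def by metis

text \<open>The assumptions are symmetric in \<open>X\<close> and \<open>Y\<close>, so this covers
  both orders of the factors.\<close>

lemma ideal_prod_graded_maximal_ideals:
  assumes wp: "\<And>P. proper_graded_ideal G R A P \<Longrightarrow> graded_weakly_prime_ideal G R A P"
    and X: "graded_maximal_ideal G R A X" and Y: "graded_maximal_ideal G R A Y" and "X \<noteq> Y"
  shows "ideal_prod R X Y = {\<zero>\<^bsub>R\<^esub>}"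
proof (rule ccontr)
  assume "ideal_prod R X Y \<noteq> {\<zero>\<^bsub>R\<^esub>}"
  have g: "graded_ideal G R A X" "graded_ideal G R A Y" "X \<noteq> carrier R"
    using X Y by (auto simp: graded_maximal_ideal_def proper_graded_ideal_def)
  have sub: "ideal_prod R X Y \<subseteq> X \<inter> Y"
    using g R.ideal_prod_subset_Int by (simp add: graded_ideal_def)
  \<comment> \<open>For properness of the intersection: were \<open>X \<inter> Y\<close> all of
    \<open>R\<close>, so would be \<open>X\<close>.\<close>
  have "X \<subseteq> carrier R"
    using g(1) additive_subgroup.a_subset
    by (auto simp: graded_ideal_def nonunital_ideal_def)
  then have "proper_graded_ideal G R A (X \<inter> Y)"
    using g graded_ideal_Int unfolding proper_graded_ideal_def by blast
  then have "X \<subseteq> X \<inter> Y \<or> Y \<subseteq> X \<inter> Y"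
    using wp[of "X \<inter> Y"] g sub \<open>ideal_prod R X Y \<noteq> {\<zero>\<^bsub>R\<^esub>}\<close>
    unfolding graded_weakly_prime_ideal_def by blast
  then show False
    using graded_maximal_ideals_not_subset assms by blast
qed

end

section \<open>Ideals as rings, and the splitting of a unital graded ring\<close>

text \<open>The unity is a parameter, since the unity of \<open>R\<close> lies outside every proper
  ideal; the suitable \<open>e\<close> comes from splitting \<open>1\<close>. Extra record fields of
  \<open>R\<close> are dropped, which gives the type \<open>'a ring\<close>.\<close>

definition ideal_ring :: "('a, 'm) ring_scheme \<Rightarrow> 'a set \<Rightarrow> 'a \<Rightarrow> 'a ring" where
  "ideal_ring R I e =
     \<lparr>carrier = I, mult = mult R, one = e, zero = zero R, add = add R\<rparr>"

lemma ideal_ring_simps [simp]: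
  "carrier (ideal_ring R I e) = I" "mult (ideal_ring R I e) = mult R"
  "one (ideal_ring R I e) = e" "zero (ideal_ring R I e) = zero R"
  "add (ideal_ring R I e) = add R"
  by (simp_all add: ideal_ring_def)

lemma (in nonunital_ideal) nonunital_ring_ideal_ring: "nonunital_ring (ideal_ring R I e)"
proof -
  have "abelian_group (ideal_ring R I e)"
  proof (rule abelian_groupI)
    show "\<exists>y\<in>carrier (ideal_ring R I e). y \<oplus>\<^bsub>ideal_ring R I e\<^esub> x = \<zero>\<^bsub>ideal_ring R I e\<^esub>"
      if "x \<in> carrier (ideal_ring R I e)" for x
      using that by (intro bexI[of _ "\<ominus> x"]) (simp_all add: l_neg)
  qed (simp_all add: a_ac)
  then show ?thesis
    by (auto intro!: nonunital_ring.intro nonunital_ring_axioms.intro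
        simp: I_l_closed m_assoc l_distr r_distr)
qed

text \<open>Here \<open>1 = e + f\<close> gives \<open>X + Y = R\<close>, so with zero intersection
  \<open>R\<close> is the direct sum of \<open>X\<close> and \<open>Y\<close>, and multiplication by
  \<open>e\<close> and \<open>f\<close> gives the projections. The setting is symmetric, so
  \<open>swap\<close> carries results on \<open>X\<close> over to \<open>Y\<close>.\<close>

locale graded_decomposition = graded_ring G R A + Rring?: ring R
  for G (structure) and R (structure) and A +
  fixes X Y e f
  assumes graded_X: "graded_ideal G R A X" and graded_Y: "graded_ideal G R A Y"
    and Int_zero: "X \<inter> Y = {\<zero>\<^bsub>R\<^esub>}"
    and e_mem: "e \<in> X" and f_mem: "f \<in> Y" and one_eq: "\<one>\<^bsub>R\<^esub> = e \<oplus>\<^bsub>R\<^esub> f"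
begin

sublocale X: nonunital_ideal X R using graded_X by (simp add: graded_ideal_def)
sublocale Y: nonunital_ideal Y R using graded_Y by (simp add: graded_ideal_def)

lemma mult_zero:
  assumes "x \<in> X" "y \<in> Y"
  shows "x \<otimes>\<^bsub>R\<^esub> y = \<zero>\<^bsub>R\<^esub>" "y \<otimes>\<^bsub>R\<^esub> x = \<zero>\<^bsub>R\<^esub>"
proof -
  have "x \<otimes>\<^bsub>R\<^esub> y \<in> X \<inter> Y" "y \<otimes>\<^bsub>R\<^esub> x \<in> X \<inter> Y"
    using assms by (simp_all add: X.I_l_closed X.I_r_closed Y.I_l_closed Y.I_r_closed)
  then show "x \<otimes>\<^bsub>R\<^esub> y = \<zero>\<^bsub>R\<^esub>" "y \<otimes>\<^bsub>R\<^esub> x = \<zero>\<^bsub>R\<^esub>"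
    unfolding Int_zero by simp_all
qed

lemma swap: "graded_decomposition G R A Y X f e"
  using graded_X graded_Y Int_zero e_mem f_mem one_eq R.a_comm[of e f]
  by unfold_locales auto

text \<open>Expand \<open>1 x\<close> and \<open>x 1\<close> with \<open>1 = e + f\<close>; the
  terms with \<open>f\<close> vanish by \<open>mult_zero\<close>.\<close>

lemma e_unit:
  assumes x: "x \<in> X"
  shows "e \<otimes>\<^bsub>R\<^esub> x = x" "x \<otimes>\<^bsub>R\<^esub> e = x"
proof -
  have "(e \<oplus>\<^bsub>R\<^esub> f) \<otimes>\<^bsub>R\<^esub> x = x" "x \<otimes>\<^bsub>R\<^esub> (e \<oplus>\<^bsub>R\<^esub> f) = x"
    using x by (simp_all flip: one_eq)
  then show "e \<otimes>\<^bsub>R\<^esub> x = x" "x \<otimes>\<^bsub>R\<^esub> e = x"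
    using x e_mem f_mem mult_zero[OF x f_mem] by (simp_all add: R.l_distr R.r_distr)
qed

text \<open>Since \<open>e x\<close> lies in \<open>X\<close>, where \<open>e\<close> is a right
  unit, \<open>(e x)(e y) = ((e x) e) y = (e x) y\<close>.\<close>

lemma e_mult_hom:
  assumes "x \<in> carrier R" "y \<in> carrier R"
  shows "e \<otimes>\<^bsub>R\<^esub> (x \<otimes>\<^bsub>R\<^esub> y) = (e \<otimes>\<^bsub>R\<^esub> x) \<otimes>\<^bsub>R\<^esub> (e \<otimes>\<^bsub>R\<^esub> y)"
proof -
  have ex: "e \<otimes>\<^bsub>R\<^esub> x \<in> X" using assms X.I_r_closed e_mem by blast
  have "(e \<otimes>\<^bsub>R\<^esub> x) \<otimes>\<^bsub>R\<^esub> (e \<otimes>\<^bsub>R\<^esub> y) = ((e \<otimes>\<^bsub>R\<^esub> x) \<otimes>\<^bsub>R\<^esub> e) \<otimes>\<^bsub>R\<^esub> y"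
    using assms ex e_mem by (simp add: R.m_assoc)
  then show ?thesis
    using ex e_unit assms e_mem by (simp add: R.m_assoc)
qed

lemma decomp: "x \<in> carrier R \<Longrightarrow> x = e \<otimes>\<^bsub>R\<^esub> x \<oplus>\<^bsub>R\<^esub> f \<otimes>\<^bsub>R\<^esub> x"
  using e_mem f_mem R.l_distr[of e f x] by (simp flip: one_eq)

text \<open>No degree of \<open>e\<close> enters: take the components of degree \<open>g\<close> in
  \<open>x = e x + f x\<close>, then multiply by \<open>e\<close> to isolate the part in
  \<open>X\<close>.\<close>

lemma e_mult_homogeneous:
  assumes g: "g \<in> carrier G" and x: "x \<in> A g"
  shows "e \<otimes>\<^bsub>R\<^esub> x \<in> X \<inter> A g"
proof -
  have xR: "x \<in> carrier R"
    using additive_subgroup.a_Hcarr[OF homogeneous_subgroup[OF g] x] .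
  let ?a = "e \<otimes>\<^bsub>R\<^esub> x" and ?b = "f \<otimes>\<^bsub>R\<^esub> x"
  have a: "?a \<in> X" and b: "?b \<in> Y" using xR X.I_r_closed Y.I_r_closed e_mem f_mem by auto
  have pa: "proj ?a g \<in> X" and pb: "proj ?b g \<in> Y"
    using a b g graded_X graded_Y by (auto simp: graded_ideal_iff)
  have "?a \<oplus>\<^bsub>R\<^esub> ?b = proj (?a \<oplus>\<^bsub>R\<^esub> ?b) g"
    using proj_homogeneous[OF g x] by (simp flip: decomp[OF xR])
  also have "\<dots> = proj ?a g \<oplus>\<^bsub>R\<^esub> proj ?b g"
    using proj_add a b g by simp
  finally have "e \<otimes>\<^bsub>R\<^esub> (?a \<oplus>\<^bsub>R\<^esub> ?b) = e \<otimes>\<^bsub>R\<^esub> (proj ?a g \<oplus>\<^bsub>R\<^esub> proj ?b g)" by simp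
  \<comment> \<open>Left multiplication by \<open>e\<close> fixes the summands in \<open>X\<close>
    and kills those in \<open>Y\<close>.\<close>
  then have "?a = proj ?a g"
    using a b pa pb e_mem mult_zero e_unit by (simp add: R.r_distr)
  moreover have "proj ?a g \<in> A g" using a g by (simp add: proj_mem)
  ultimately show ?thesis using a by simp
qed

lemma internal_direct_sum_ideal_ring:
  assumes "B \<subseteq> X"
  shows "internal_direct_sum (ideal_ring R X e) B (carrier G) (\<lambda>g. B \<inter> A g) \<longleftrightarrow>
         internal_direct_sum R B (carrier G) (\<lambda>g. B \<inter> A g)"
  using assms X.nonunital_ring_ideal_ring[of e] X.is_additive_subgroup
  by (intro R.internal_direct_sum_restrict_carrier) (auto simp: nonunital_ring_def)

text \<open>The direct sum condition is the gradedness of the ideal \<open>X\<close>, read with the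
  operations of the ring \<open>X\<close>.\<close>

lemma graded_ring_ideal_ring: "graded_ring G (ideal_ring R X e) (\<lambda>g. X \<inter> A g)"
proof (intro graded_ring.intro graded_ring_axioms.intro)
  show "group G" by (rule G.group_axioms)
  show "nonunital_ring (ideal_ring R X e)" by (rule X.nonunital_ring_ideal_ring)
  show "internal_direct_sum (ideal_ring R X e) (carrier (ideal_ring R X e)) (carrier G) (\<lambda>g. X \<inter> A g)"
    using graded_X internal_direct_sum_ideal_ring[of X] by (simp add: graded_ideal_def)
next
  fix g h x y assume "g \<in> carrier G" "h \<in> carrier G" "x \<in> X \<inter> A g" "y \<in> X \<inter> A h"
  then show "x \<otimes>\<^bsub>ideal_ring R X e\<^esub> y \<in> X \<inter> A (g \<otimes>\<^bsub>G\<^esub> h)"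
    using graded_mult X.I_r_closed by auto
qed

lemma ring_ideal_ring: "ring (ideal_ring R X e)"
proof -
  interpret S: nonunital_ring "ideal_ring R X e" by (rule X.nonunital_ring_ideal_ring)
  show ?thesis
    using S.abelian_group_axioms S.m_closed S.m_assoc S.l_distr S.r_distr e_unit e_mem
    by (intro ring.intro ring_axioms.intro monoid.intro) auto
qed

text \<open>An ideal of an ideal need not be an ideal of \<open>R\<close>. Here it is, because
  \<open>e\<close> is a unity of \<open>X\<close>: for \<open>a\<close> in \<open>I\<close>,
  \<open>x a = (x e) a\<close> and \<open>a x = a (e x)\<close>, with \<open>x e\<close> and
  \<open>e x\<close> in \<open>X\<close>.\<close>

lemma graded_ideal_of_ideal_ring:
  assumes "graded_ideal G (ideal_ring R X e) (\<lambda>g. X \<inter> A g) I"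
  shows "graded_ideal G R A I" "I \<subseteq> X"
proof -
  let ?S = "ideal_ring R X e"
  from assms interpret I: nonunital_ideal I ?S by (simp add: graded_ideal_def)
  show IX: "I \<subseteq> X" using I.a_subset by simp
  \<comment> \<open>The grading of \<open>I\<close> inherited from \<open>X\<close> is thus the one
    inherited from \<open>R\<close>.\<close>
  then have "I \<inter> (X \<inter> A g) = I \<inter> A g" for g by blast
  then have ds: "internal_direct_sum R I (carrier G) (\<lambda>g. I \<inter> A g)"
    using assms internal_direct_sum_ideal_ring[OF IX] by (simp add: graded_ideal_def)
  have sub: "additive_subgroup I R" using ds by (simp add: internal_direct_sum_def)
  have "x \<otimes>\<^bsub>R\<^esub> a \<in> I" "a \<otimes>\<^bsub>R\<^esub> x \<in> I" if a: "a \<in> I" and x: "x \<in> carrier R" for a x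
  proof -
    have aX: "a \<in> X" using a IX by blast
    have "x \<otimes>\<^bsub>R\<^esub> a = (x \<otimes>\<^bsub>R\<^esub> e) \<otimes>\<^bsub>R\<^esub> a" "a \<otimes>\<^bsub>R\<^esub> x = a \<otimes>\<^bsub>R\<^esub> (e \<otimes>\<^bsub>R\<^esub> x)"
      using aX x e_mem e_unit[OF aX] R.m_assoc[of x e a] R.m_assoc[of a e x] by simp_all
    moreover have "x \<otimes>\<^bsub>R\<^esub> e \<in> X" "e \<otimes>\<^bsub>R\<^esub> x \<in> X"
      using x e_mem X.I_l_closed X.I_r_closed by auto
    ultimately show "x \<otimes>\<^bsub>R\<^esub> a \<in> I" "a \<otimes>\<^bsub>R\<^esub> x \<in> I"
      using I.I_l_closed[OF a] I.I_r_closed[OF a] unfolding ideal_ring_simps by metis+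
  qed
  then have "nonunital_ideal I R"
    using sub R.nonunital_ring_axioms
    by (intro nonunital_ideal.intro nonunital_ideal_axioms.intro)
  then show "graded_ideal G R A I" using ds by (simp add: graded_ideal_def)
qed

text \<open>The hypothesis concerns the complement \<open>Y\<close>, as the ring \<open>X\<close> is
  a copy of \<open>R / Y\<close>.\<close>

lemma graded_simple_ideal_ring:
  assumes Y: "graded_maximal_ideal G R A Y"
  shows "graded_simple_ring G (ideal_ring R X e) (\<lambda>g. X \<inter> A g)"
  unfolding graded_simple_ring_def
proof (intro conjI allI impI)
  show "graded_ring G (ideal_ring R X e) (\<lambda>g. X \<inter> A g)" by (rule graded_ring_ideal_ring)
  show "ring (ideal_ring R X e)" by (rule ring_ideal_ring)
  \<comment> \<open>Properness of \<open>Y\<close> makes \<open>X\<close> nonzero: otherwise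
    \<open>e = 0\<close>, and each \<open>x = f x\<close> lies in \<open>Y\<close>.\<close>
  have "carrier R \<subseteq> Y" if "X = {\<zero>\<^bsub>R\<^esub>}"
  proof
    fix x assume x: "x \<in> carrier R"
    have "e = \<zero>\<^bsub>R\<^esub>" using e_mem that by simp
    then have "x = f \<otimes>\<^bsub>R\<^esub> x" using decomp[OF x, symmetric] x f_mem by simp
    then show "x \<in> Y" using x f_mem Y.I_r_closed by metis
  qed
  then show "carrier (ideal_ring R X e) \<noteq> {\<zero>\<^bsub>ideal_ring R X e\<^esub>}"
    using Y Y.a_subset by (auto simp: graded_maximal_ideal_def proper_graded_ideal_def)
next
  fix I assume "graded_ideal G (ideal_ring R X e) (\<lambda>g. X \<inter> A g) I"
  then have I: "graded_ideal G R A I" and IX: "I \<subseteq> X"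
    using graded_ideal_of_ideal_ring by blast+
  interpret I: nonunital_ideal I R using I by (simp add: graded_ideal_def)
  have "X \<subseteq> I" if "\<not> I \<subseteq> Y"
  proof
    fix x assume x: "x \<in> X"
    then have "x \<in> I <+>\<^bsub>R\<^esub> Y"
      using graded_maximal_ideal_add[OF Y I that] by simp
    then obtain i y where iy: "i \<in> I" "y \<in> Y" "x = i \<oplus>\<^bsub>R\<^esub> y"
      by (auto simp: set_add_def')
    have iX: "i \<in> X" using iy IX by blast
    \<comment> \<open>Multiplying \<open>i + y\<close> by \<open>e\<close> removes \<open>y\<close>
      and fixes \<open>i\<close>, so \<open>x\<close> is \<open>i\<close> itself.\<close>
    have "x = e \<otimes>\<^bsub>R\<^esub> (i \<oplus>\<^bsub>R\<^esub> y)" using e_unit[OF x] iy by simp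
    also have "\<dots> = i" using iX iy e_mem e_unit[OF iX] mult_zero by (simp add: R.r_distr)
    finally show "x \<in> I" using iy by simp
  qed
  moreover have "I = {\<zero>\<^bsub>R\<^esub>}" if "I \<subseteq> Y"
    using that IX Int_zero I.zero_closed by blast
  ultimately show "I = {\<zero>\<^bsub>ideal_ring R X e\<^esub>} \<or> I = carrier (ideal_ring R X e)"
    using IX by auto
qed

lemma graded_ring_iso_RDirProd:
  "(\<lambda>x. (e \<otimes>\<^bsub>R\<^esub> x, f \<otimes>\<^bsub>R\<^esub> x)) \<in> graded_ring_iso G R A
     (RDirProd (ideal_ring R X e) (ideal_ring R Y f)) (\<lambda>g. (X \<inter> A g) \<times> (Y \<inter> A g))"
proof -
  interpret swap: graded_decomposition G R A Y X f e by (rule swap)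
  let ?h = "\<lambda>x. (e \<otimes>\<^bsub>R\<^esub> x, f \<otimes>\<^bsub>R\<^esub> x)"
  let ?S = "RDirProd (ideal_ring R X e) (ideal_ring R Y f)"
  have hX: "e \<otimes>\<^bsub>R\<^esub> x \<in> X" "f \<otimes>\<^bsub>R\<^esub> x \<in> Y" if "x \<in> carrier R" for x
    using that e_mem f_mem by (simp_all add: X.I_r_closed Y.I_r_closed)
  \<comment> \<open>Used twice: for the inverse of \<open>?h\<close>, and for the preimage of a pair
    of elements of degree \<open>g\<close>.\<close>
  have h_add: "?h (a \<oplus>\<^bsub>R\<^esub> b) = (a, b)" if "a \<in> X" "b \<in> Y" for a b
    using that e_mem f_mem e_unit(1)[OF that(1)] swap.e_unit(1)[OF that(2)]
      mult_zero(1)[OF e_mem that(2)] mult_zero(2)[OF that(1) f_mem]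
    by (simp add: R.r_distr)
  have S: "carrier ?S = X \<times> Y" "\<And>a b c d. (a, b) \<otimes>\<^bsub>?S\<^esub> (c, d) = (a \<otimes>\<^bsub>R\<^esub> c, b \<otimes>\<^bsub>R\<^esub> d)"
    "\<And>a b c d. (a, b) \<oplus>\<^bsub>?S\<^esub> (c, d) = (a \<oplus>\<^bsub>R\<^esub> c, b \<oplus>\<^bsub>R\<^esub> d)" "\<one>\<^bsub>?S\<^esub> = (e, f)"
    by (auto simp: RDirProd_def DirProd_def monoid.defs)
  have "?h \<in> ring_iso R ?S"
  proof (rule ring_iso_memI)
    \<comment> \<open>The inverse adds the two coordinates; \<open>decomp\<close> and
      \<open>h_add\<close> compute the two composites.\<close>
    show "bij_betw ?h (carrier R) (carrier ?S)"
    proof (rule bij_betw_byWitness[where f' = "\<lambda>(a, b). a \<oplus>\<^bsub>R\<^esub> b"])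
      show "\<forall>x\<in>carrier R. (\<lambda>(a, b). a \<oplus>\<^bsub>R\<^esub> b) (?h x) = x" by (simp flip: decomp)
      show "\<forall>p\<in>carrier ?S. ?h ((\<lambda>(a, b). a \<oplus>\<^bsub>R\<^esub> b) p) = p" using h_add by (auto simp: S)
    qed (use hX in \<open>auto simp: S\<close>)
    show "?h x \<in> carrier ?S" if "x \<in> carrier R" for x
      using hX[OF that] by (simp add: S)
    show "?h (x \<otimes>\<^bsub>R\<^esub> y) = ?h x \<otimes>\<^bsub>?S\<^esub> ?h y" if "x \<in> carrier R" "y \<in> carrier R" for x y
      unfolding S using e_mult_hom[OF that] swap.e_mult_hom[OF that] by (rule arg_cong2)
    show "?h (x \<oplus>\<^bsub>R\<^esub> y) = ?h x \<oplus>\<^bsub>?S\<^esub> ?h y" if "x \<in> carrier R" "y \<in> carrier R" for x y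
      using that e_mem f_mem by (simp add: S R.r_distr)
    show "?h \<one>\<^bsub>R\<^esub> = \<one>\<^bsub>?S\<^esub>"
      using e_mem f_mem by (simp add: S)
  qed
  moreover have "?h ` A g = (X \<inter> A g) \<times> (Y \<inter> A g)" if g: "g \<in> carrier G" for g
  proof
    show "?h ` A g \<subseteq> (X \<inter> A g) \<times> (Y \<inter> A g)"
      using e_mult_homogeneous[OF g] swap.e_mult_homogeneous[OF g] by auto
    show "(X \<inter> A g) \<times> (Y \<inter> A g) \<subseteq> ?h ` A g"
    proof
      fix p assume "p \<in> (X \<inter> A g) \<times> (Y \<inter> A g)"
      then obtain a b where ab: "p = (a, b)" "a \<in> X" "a \<in> A g" "b \<in> Y" "b \<in> A g" by auto
      then have "a \<oplus>\<^bsub>R\<^esub> b \<in> A g"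
        using additive_subgroup.a_closed[OF homogeneous_subgroup[OF g]] by blast
      moreover have "p = ?h (a \<oplus>\<^bsub>R\<^esub> b)" unfolding ab(1) by (rule h_add[OF ab(2,4), symmetric])
      ultimately show "p \<in> ?h ` A g" by (rule rev_image_eqI)
    qed
  qed
  ultimately show ?thesis by (simp add: graded_ring_iso_def)
qed

end

section \<open>The splitting given by two graded maximal ideals\<close>

lemma (in graded_ring) ex_graded_decomposition:
  assumes wp: "\<And>P. proper_graded_ideal G R A P \<Longrightarrow> graded_weakly_prime_ideal G R A P"
    and X: "graded_maximal_ideal G R A X" and Y: "graded_maximal_ideal G R A Y" and "X \<noteq> Y"
    and "ring R"
  shows "\<exists>e f. graded_decomposition G R A X Y e f"
proof -
  interpret Rring: ring R by fact
  have g: "graded_ideal G R A X" "graded_ideal G R A Y"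
    using X Y by (auto simp: graded_maximal_ideal_def proper_graded_ideal_def)
  interpret X: nonunital_ideal X R using g by (simp add: graded_ideal_def)
  interpret Y: nonunital_ideal Y R using g by (simp add: graded_ideal_def)
  have "X <+>\<^bsub>R\<^esub> Y = carrier R"
    using graded_maximal_ideal_add[OF Y g(1)] graded_maximal_ideals_not_subset[OF X Y \<open>X \<noteq> Y\<close>]
    by blast
  then have "\<one>\<^bsub>R\<^esub> \<in> X <+>\<^bsub>R\<^esub> Y" by simp
  then obtain e f where ef: "e \<in> X" "f \<in> Y" "\<one>\<^bsub>R\<^esub> = e \<oplus>\<^bsub>R\<^esub> f"
    by (auto simp: set_add_def')
  have "y = \<zero>\<^bsub>R\<^esub>" if y: "y \<in> X" "y \<in> Y" for y
  proof -
    \<comment> \<open>Here \<open>y\<close> counts as an element of \<open>Y\<close> against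
      \<open>e\<close> in \<open>X\<close>, and as an element of \<open>X\<close> against
      \<open>f\<close> in \<open>Y\<close>; both vanishing products are used.\<close>
    have "y \<otimes>\<^bsub>R\<^esub> e \<in> ideal_prod R Y X" "y \<otimes>\<^bsub>R\<^esub> f \<in> ideal_prod R X Y"
      using y ef by (auto intro: ideal_prod.prod)
    then have "y \<otimes>\<^bsub>R\<^esub> e = \<zero>\<^bsub>R\<^esub>" "y \<otimes>\<^bsub>R\<^esub> f = \<zero>\<^bsub>R\<^esub>"
      using ideal_prod_graded_maximal_ideals[OF wp X Y \<open>X \<noteq> Y\<close>]
        ideal_prod_graded_maximal_ideals[OF wp Y X \<open>X \<noteq> Y\<close>[symmetric]] by auto
    moreover have "y \<otimes>\<^bsub>R\<^esub> (e \<oplus>\<^bsub>R\<^esub> f) = y" using y by (simp flip: ef(3))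
    ultimately show ?thesis using y ef by (simp add: R.r_distr)
  qed
  then have "X \<inter> Y = {\<zero>\<^bsub>R\<^esub>}" by auto
  then have "graded_decomposition G R A X Y e f"
    using g ef by unfold_locales auto
  then show ?thesis by blast
qed

theorem proposition2p11:
  fixes G :: "('g, 'n) monoid_scheme" and R :: "('a, 'm) ring_scheme"
    and A :: "'g \<Rightarrow> 'a set" and X1 X2 :: "'a set"
  assumes "graded_ring G R A"
    and "\<And>P. proper_graded_ideal G R A P \<Longrightarrow> graded_weakly_prime_ideal G R A P"
    and "graded_maximal_ideal G R A X1" and "graded_maximal_ideal G R A X2" and "X1 \<noteq> X2"
  shows "ideal_prod R X1 X2 = {\<zero>\<^bsub>R\<^esub>} \<and> ideal_prod R X2 X1 = {\<zero>\<^bsub>R\<^esub>} \<and>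
    (ring R \<longrightarrow>
      (\<exists>(S1 :: 'a ring) A1 (S2 :: 'a ring) A2.
         graded_simple_ring G S1 A1 \<and> graded_simple_ring G S2 A2 \<and>
         graded_ring_iso G R A (RDirProd S1 S2) (\<lambda>g. A1 g \<times> A2 g) \<noteq> {}))"
proof (intro conjI impI)
  interpret graded_ring G R A by fact
  show "ideal_prod R X1 X2 = {\<zero>\<^bsub>R\<^esub>}"
    by (rule ideal_prod_graded_maximal_ideals[OF assms(2-5)])
  show "ideal_prod R X2 X1 = {\<zero>\<^bsub>R\<^esub>}"
    by (rule ideal_prod_graded_maximal_ideals[OF assms(2,4,3) assms(5)[symmetric]])
  assume "ring R"
  then obtain e f where "graded_decomposition G R A X1 X2 e f"
    using ex_graded_decomposition[OF assms(2-5)] by blast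
  then interpret D: graded_decomposition G R A X1 X2 e f .
  interpret D': graded_decomposition G R A X2 X1 f e by (rule D.swap)
  \<comment> \<open>The witnesses are \<open>X1\<close> and \<open>X2\<close> with unities
    \<open>e\<close> and \<open>f\<close>. Maximality crosses over: that of \<open>X2\<close> makes
    \<open>X1\<close> simple, and that of \<open>X1\<close> makes \<open>X2\<close> simple.\<close>
  show "\<exists>(S1 :: 'a ring) A1 (S2 :: 'a ring) A2.
         graded_simple_ring G S1 A1 \<and> graded_simple_ring G S2 A2 \<and>
         graded_ring_iso G R A (RDirProd S1 S2) (\<lambda>g. A1 g \<times> A2 g) \<noteq> {}"
    using D.graded_simple_ideal_ring[OF assms(4)] D'.graded_simple_ideal_ring[OF assms(3)]
      D.graded_ring_iso_RDirProd by blast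
qed

end
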